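(* Let $(Z,\rho_0)$ be a finite antipodal space with $Z=\{1,\dots,n\}$, $n\ge4$. (1) If $R_1,R_2$ are antipodal relations and $\emptyset\ne R_1\subseteq R_2$, then $C(R_2)$ is a face of $C(R_1)$. (2) If $R$ is an antipodal relation and $F\subset C(R)$ is a proper non-empty face of $C(R)$, then $F=C(R')$ for some antipodal relation $R'$ with $R\subset R'$.
   Context: Let $Z=\{1,\dots,n\}$, $n\ge4$. A separating function on $Z$ is a symmetric function $\rho:Z\times Z\to[0,\infty)$ with $\rho(i,j)=0$ iff $i=j$. It is antipodal if $\max\rho=1$ and for every $i$ there is $j$ with $\rho(i,j)=1$; then $(Z,\rho)$ is called a (finite) antipodal space. Two separating functions $\rho,\rho'$ are Moebius equivalent if $\frac{\rho(i,k)\rho(j,l)}{\rho(i,l)\rho(j,k)}=\frac{\rho'(i,k)\rho'(j,l)}{\rho'(i,l)\rho'(j,k)}$ for all distinct $i,j,k,l$; equivalently (known fact) there is $\phi:Z\to(0,\infty)$ with $\rho'(i,j)^2=\phi(i)\phi(j)\rho(i,j)^2$ for all $i,j$. Fix an antipodal function $\rho_0$ on $Z$, and let $\mathcal{M}(Z)$ be the set of antipodal functions on $Z$ Moebius equivalent to $\rho_0$. Let $\Delta=\{(i,i):i\in Z\}$. For $\rho\in\mathcal{M}(Z)$ let $R_\rho=\{(i,j):\rho(i,j)=1\}\subseteq (Z\times Z)\setminus\Delta$. A symmetric relation $R\subseteq(Z\times Z)\setminus\Delta$ is called antipodal if it is empty or equals $R_\rho$ for some $\rho\in\mathcal{M}(Z)$.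 For $i\ne j$ put $a_{ij}=\log(\rho_0(i,j)^2)$ and $l_{ij}(\tau)=\tau_i+\tau_j+a_{ij}$ for $\tau\in\mathbb{R}^n$. For a non-empty antipodal relation $R$, $$C(R)=\{\tau\in\mathbb{R}^n: l_{ij}(\tau)=0\ \forall (i,j)\in R,\ l_{ij}(\tau)\le0\ \forall (i,j)\notin\Delta\},$$ which is a polyhedron (an intersection of finitely many closed half-spaces). By convention $C(\emptyset)=\emptyset$. A (non-empty) face of a polyhedron $P\subset\mathbb{R}^n$ is a non-empty set $H\cap P$, where $H$ is a hyperplane such that $P$ lies in one of the two closed half-spaces bounded by $H$; it is proper if $H\cap P\ne P$. *)

theory Defs
  imports "HOL-Analysis.Analysis"
begin

text \<open>
  The finite set \<open>Z\<close> is the universe of a finite index type \<open>'n\<close>, so that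
  \<open>real ^ 'n\<close> is the Euclidean space with one coordinate for each point of \<open>Z\<close>.
\<close>

definition separating_function :: "('n \<Rightarrow> 'n \<Rightarrow> real) \<Rightarrow> bool" where
  "separating_function \<rho> \<longleftrightarrow>
     (\<forall>i j. \<rho> i j \<ge> 0) \<and> (\<forall>i j. \<rho> i j = \<rho> j i) \<and> (\<forall>i j. \<rho> i j = 0 \<longleftrightarrow> i = j)"

definition antipodal_function :: "('n::finite \<Rightarrow> 'n \<Rightarrow> real) \<Rightarrow> bool" where
  "antipodal_function \<rho> \<longleftrightarrow>
     separating_function \<rho> \<and> Max {\<rho> i j | i j. True} = 1 \<and> (\<forall>i. \<exists>j. \<rho> i j = 1)"

definition moebius_equivalent ::
  "('n \<Rightarrow> 'n \<Rightarrow> real) \<Rightarrow> ('n \<Rightarrow> 'n \<Rightarrow> real) \<Rightarrow> bool" where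
  "moebius_equivalent \<rho> \<rho>' \<longleftrightarrow>
     (\<forall>i j k l. distinct [i, j, k, l] \<longrightarrow>
        (\<rho> i k * \<rho> j l) / (\<rho> i l * \<rho> j k) = (\<rho>' i k * \<rho>' j l) / (\<rho>' i l * \<rho>' j k))"

definition antipodal_class ::
  "('n::finite \<Rightarrow> 'n \<Rightarrow> real) \<Rightarrow> ('n \<Rightarrow> 'n \<Rightarrow> real) set" where
  "antipodal_class \<rho>0 = {\<rho>. antipodal_function \<rho> \<and> moebius_equivalent \<rho>0 \<rho>}"

definition unit_relation :: "('n \<Rightarrow> 'n \<Rightarrow> real) \<Rightarrow> ('n \<times> 'n) set" where
  "unit_relation \<rho> = {(i, j). \<rho> i j = 1}"

definition antipodal_relation ::
  "('n::finite \<Rightarrow> 'n \<Rightarrow> real) \<Rightarrow> ('n \<times> 'n) set \<Rightarrow> bool" where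
  "antipodal_relation \<rho>0 R \<longleftrightarrow>
     sym R \<and> R \<subseteq> - Id \<and> (R = {} \<or> (\<exists>\<rho>\<in>antipodal_class \<rho>0. R = unit_relation \<rho>))"

definition log_coeff :: "('n \<Rightarrow> 'n \<Rightarrow> real) \<Rightarrow> 'n \<Rightarrow> 'n \<Rightarrow> real" where
  "log_coeff \<rho>0 i j = ln ((\<rho>0 i j)\<^sup>2)"

text \<open>Only meaningful for \<open>i \<noteq> j\<close>, since \<open>\<rho>0 i i = 0\<close>.\<close>

definition log_form ::
  "('n::finite \<Rightarrow> 'n \<Rightarrow> real) \<Rightarrow> 'n \<Rightarrow> 'n \<Rightarrow> real ^ 'n \<Rightarrow> real" where
  "log_form \<rho>0 i j \<tau> = \<tau> $ i + \<tau> $ j + log_coeff \<rho>0 i j"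

definition cell ::
  "('n::finite \<Rightarrow> 'n \<Rightarrow> real) \<Rightarrow> ('n \<times> 'n) set \<Rightarrow> (real ^ 'n) set" where
  "cell \<rho>0 R =
     (if R = {} then {}
      else {\<tau>. (\<forall>(i, j)\<in>R. log_form \<rho>0 i j \<tau> = 0) \<and>
                (\<forall>i j. i \<noteq> j \<longrightarrow> log_form \<rho>0 i j \<tau> \<le> 0)})"

text \<open>
  Faces are non-empty and are cut out by a genuine hyperplane (\<open>a \<noteq> 0\<close>). In contrast to
  \<open>exposed_face_of\<close>, the empty set is never a face, and \<open>P\<close> is a face of itself only if it
  is non-empty and contained in a hyperplane.
\<close>

definition nonempty_face :: "'a::euclidean_space set \<Rightarrow> 'a set \<Rightarrow> bool" where
  "nonempty_face F P \<longleftrightarrow>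
     F \<noteq> {} \<and>
     (\<exists>a b. a \<noteq> 0 \<and>
        (P \<subseteq> {x. a \<bullet> x \<le> b} \<or> P \<subseteq> {x. a \<bullet> x \<ge> b}) \<and>
        F = {x. a \<bullet> x = b} \<inter> P)"

definition proper_nonempty_face :: "'a::euclidean_space set \<Rightarrow> 'a set \<Rightarrow> bool" where
  "proper_nonempty_face F P \<longleftrightarrow> nonempty_face F P \<and> F \<noteq> P"

end

theory Submission
  imports Defs
begin

text \<open>
  A Moebius equivalence is a rescaling: \<open>\<rho>(i,j)\<^sup>2 = exp (\<tau>\<^sub>i + \<tau>\<^sub>j) \<rho>0(i,j)\<^sup>2\<close>, so the non-empty
  antipodal relations are exactly the sets of constraints \<open>l\<^sub>i\<^sub>j \<le> 0\<close> that are tight at a feasible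
  point \<open>\<tau>\<close>, provided that every index occurs in a tight constraint. Summing the forms \<open>l\<^sub>i\<^sub>j\<close> over
  \<open>R2\<close> gives a supporting hyperplane that cuts \<open>C(R2)\<close> out of \<open>C(R1)\<close>. Conversely, a face \<open>F\<close> has a
  point at which only those constraints are tight that are tight on all of \<open>F\<close>; a segment from any
  other point satisfying these equations can be prolonged a little beyond it within the cell, so
  that its starting point must lie on the supporting hyperplane too.
\<close>

section \<open>Moebius equivalence as rescaling\<close>

text \<open>A split forces \<open>t i = (b i j + b i k - b j k) / 2\<close> for every admissible
  \<open>j\<close> and \<open>k\<close>. The cross identity makes this value independent of the
  choice, so it can serve as the definition.\<close>

lemma additive_split_of_cross_differences:
  fixes b :: "'n::finite \<Rightarrow> 'n \<Rightarrow> real"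
  assumes card: "CARD('n) \<ge> 4"
    and sym: "\<And>i j. b i j = b j i"
    and cross: "\<And>i j k l. distinct [i, j, k, l] \<Longrightarrow> b i k + b j l = b i l + b j k"
  obtains t where "\<And>i j. i \<noteq> j \<Longrightarrow> b i j = t i + t j"
proof -
  have ex_notin: "\<exists>x. x \<notin> S" if "card S \<le> 3" for S :: "'n set"
    using that card by (metis Suc_n_not_le_n UNIV_eq_I eval_nat_numeral(2) le_trans semiring_norm(26,27))
  define s where "s i j k = (b i j + b i k - b j k) / 2" for i j k
  have s_swap: "s i j k = s i k j" for i j k
    using sym[of j k] by (simp add: s_def)
  have s_change: "s i j k = s i j k'" if "distinct [i, j, k]" "distinct [i, j, k']" for i j k k'
    using that cross[of i j k k'] by (cases "k = k'") (auto simp: s_def)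
  \<comment> \<open>One index is exchanged at a time, from \<open>{j, k}\<close> over
    \<open>{j, k'}\<close> to \<open>{j', k'}\<close>. The middle pair degenerates if
    \<open>j = k'\<close>, and then a single exchange suffices.\<close>
  have s_indep: "s i j k = s i j' k'" if "distinct [i, j, k]" "distinct [i, j', k']" for i j k j' k'
  proof (cases "j = k'")
    case True
    then show ?thesis
      using that s_swap s_change[of i j k j'] by auto
  next
    case False
    then show ?thesis
      using that s_swap s_change[of i j k k'] s_change[of i k' j j'] by auto
  qed
  define t where "t i = (SOME x. \<exists>j k. distinct [i, j, k] \<and> x = s i j k)" for i
  have t_eq: "t i = s i j k" if "distinct [i, j, k]" for i j k
    unfolding t_def using that s_indep by (intro some_equality) blast+
  have "b i j = t i + t j" if "i \<noteq> j" for i j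
  proof -
    have "card {i, j} \<le> 3"
      using that by simp
    \<comment> \<open>With a common third index \<open>k\<close>, the sum
      \<open>s i j k + s j i k\<close> collapses to \<open>b i j\<close>.\<close>
    then obtain k where "k \<notin> {i, j}"
      using ex_notin by blast
    then show ?thesis
      using that t_eq[of i j k] t_eq[of j i k] sym[of i j] by (auto simp: s_def)
  qed
  then show ?thesis using that by blast
qed

lemma separating_function_pos:
  assumes "separating_function \<rho>" "i \<noteq> j"
  shows "\<rho> i j > 0"
  using assms unfolding separating_function_def by (metis order_le_less)

lemma antipodal_function_iff:
  fixes \<rho> :: "'n::finite \<Rightarrow> 'n \<Rightarrow> real"
  shows "antipodal_function \<rho> \<longleftrightarrow>
    separating_function \<rho> \<and> (\<forall>i j. \<rho> i j \<le> 1) \<and> (\<forall>i. \<exists>j. \<rho> i j = 1)"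
proof -
  have "{\<rho> i j | i j. True} = range (case_prod \<rho>)"
    by auto
  then have fin: "finite {\<rho> i j | i j. True}"
    by simp
  show ?thesis
    unfolding antipodal_function_def using fin by (subst Max_eq_iff) auto
qed

text \<open>This translates between functions and points: for a rescaling \<open>\<rho>\<close> of
  \<open>\<rho>0\<close>, the conditions \<open>\<rho> i j \<le> 1\<close> and
  \<open>\<rho> i j = 1\<close> become sign conditions on an affine form in
  \<open>\<tau>\<close>.\<close>

lemma log_form_eq_ln:
  assumes "separating_function \<rho>0" "i \<noteq> j"
    and "(\<rho> i j)\<^sup>2 = exp (\<tau> $ i + \<tau> $ j) * (\<rho>0 i j)\<^sup>2"
  shows "log_form \<rho>0 i j \<tau> = ln ((\<rho> i j)\<^sup>2)"
  using separating_function_pos[OF assms(1,2)] assms(3)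
  by (simp add: log_form_def log_coeff_def ln_mult)

text \<open>Taking logarithms turns equality of cross-ratios into the cross identity for
  \<open>b\<close>, and exponentiating its additive split gives the scaling factors.\<close>

lemma moebius_equivalent_imp_scaling:
  fixes \<rho> \<rho>' :: "'n::finite \<Rightarrow> 'n \<Rightarrow> real"
  assumes card: "CARD('n) \<ge> 4"
    and sep: "separating_function \<rho>" "separating_function \<rho>'"
    and moeb: "moebius_equivalent \<rho> \<rho>'"
  obtains \<tau> :: "real ^ 'n" where "\<And>i j. (\<rho>' i j)\<^sup>2 = exp (\<tau> $ i + \<tau> $ j) * (\<rho> i j)\<^sup>2"
proof -
  note pos = separating_function_pos[OF sep(1)] separating_function_pos[OF sep(2)]
  define b where "b i j = ln ((\<rho>' i j)\<^sup>2) - ln ((\<rho> i j)\<^sup>2)" for i j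
  have "b i k + b j l = b i l + b j k" if d: "distinct [i, j, k, l]" for i j k l
  proof -
    have "(\<rho> i k * \<rho> j l) / (\<rho> i l * \<rho> j k) = (\<rho>' i k * \<rho>' j l) / (\<rho>' i l * \<rho>' j k)"
      using moeb d unfolding moebius_equivalent_def by blast
    then have "ln ((\<rho> i k * \<rho> j l) / (\<rho> i l * \<rho> j k)) = ln ((\<rho>' i k * \<rho>' j l) / (\<rho>' i l * \<rho>' j k))"
      by simp
    then show ?thesis
      using d pos[of i k] pos[of j l] pos[of i l] pos[of j k]
      by (simp add: b_def ln_mult ln_div ln_realpow)
  qed
  moreover have "b i j = b j i" for i j
    using sep by (simp add: b_def separating_function_def)
  ultimately obtain t where t: "\<And>i j. i \<noteq> j \<Longrightarrow> b i j = t i + t j"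
    using additive_split_of_cross_differences[OF card, of b] by metis
  \<comment> \<open>The split of \<open>b\<close> is available only off the diagonal; on the
    diagonal both sides are 0.\<close>
  have "(\<rho>' i j)\<^sup>2 = exp ((\<chi> i. t i) $ i + (\<chi> i. t i) $ j) * (\<rho> i j)\<^sup>2" for i j
  proof (cases "i = j")
    case True
    moreover have "\<rho> i i = 0" "\<rho>' i i = 0"
      using sep by (simp_all add: separating_function_def)
    ultimately show ?thesis by simp
  next
    case False
    have "exp (t i + t j) = (\<rho>' i j)\<^sup>2 / (\<rho> i j)\<^sup>2"
      unfolding t[OF False, symmetric] b_def using pos[OF False] by (simp add: exp_diff)
    then show ?thesis using pos(1)[OF False] by simp
  qed
  then show ?thesis using that by blast
qed

section \<open>Antipodal relations as sets of tight constraints\<close>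

definition feasible :: "('n::finite \<Rightarrow> 'n \<Rightarrow> real) \<Rightarrow> (real ^ 'n) set" where
  "feasible \<rho>0 = {\<tau>. \<forall>i j. i \<noteq> j \<longrightarrow> log_form \<rho>0 i j \<tau> \<le> 0}"

text \<open>The guard removes the diagonal, where \<open>log_coeff\<close> would take the logarithm
  of 0.\<close>

definition tight_relation :: "('n::finite \<Rightarrow> 'n \<Rightarrow> real) \<Rightarrow> real ^ 'n \<Rightarrow> ('n \<times> 'n) set" where
  "tight_relation \<rho>0 \<tau> = {(i, j). i \<noteq> j \<and> log_form \<rho>0 i j \<tau> = 0}"

lemma mem_cell_iff:
  assumes "R \<noteq> {}" "R \<subseteq> - Id"
  shows "\<tau> \<in> cell \<rho>0 R \<longleftrightarrow> \<tau> \<in> feasible \<rho>0 \<and> R \<subseteq> tight_relation \<rho>0 \<tau>"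
  using assms by (auto simp: cell_def feasible_def tight_relation_def)

lemma log_form_commute:
  assumes "separating_function \<rho>0"
  shows "log_form \<rho>0 i j \<tau> = log_form \<rho>0 j i \<tau>"
  using assms by (simp add: log_form_def log_coeff_def separating_function_def)

text \<open>The point is the scaling vector from \<open>\<rho>0\<close> to a function
  \<open>\<rho>\<close> with unit relation \<open>R\<close>. Feasibility expresses
  \<open>\<rho> \<le> 1\<close>, and the last clause is the antipodality of
  \<open>\<rho>\<close>.\<close>

lemma antipodal_relationE:
  fixes \<rho>0 :: "'n::finite \<Rightarrow> 'n \<Rightarrow> real"
  assumes card: "CARD('n) \<ge> 4" and sep: "separating_function \<rho>0"
    and R: "antipodal_relation \<rho>0 R" "R \<noteq> {}"
  obtains \<tau> where "\<tau> \<in> feasible \<rho>0" "R = tight_relation \<rho>0 \<tau>" "\<And>i. \<exists>j. (i, j) \<in> R"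
proof -
  obtain \<rho> where \<rho>: "antipodal_function \<rho>" "moebius_equivalent \<rho>0 \<rho>" "R = unit_relation \<rho>"
    using R unfolding antipodal_relation_def antipodal_class_def by blast
  then have \<rho>': "separating_function \<rho>" "\<And>i j. \<rho> i j \<le> 1" "\<And>i. \<exists>j. \<rho> i j = 1"
    by (auto simp: antipodal_function_iff)
  obtain \<tau> :: "real ^ 'n" where sq: "\<And>i j. (\<rho> i j)\<^sup>2 = exp (\<tau> $ i + \<tau> $ j) * (\<rho>0 i j)\<^sup>2"
    using moebius_equivalent_imp_scaling[OF card sep \<rho>'(1) \<rho>(2)] by blast
  have form: "log_form \<rho>0 i j \<tau> = 2 * ln (\<rho> i j)" if "i \<noteq> j" for i j
    using log_form_eq_ln[of \<rho>0 i j \<rho> \<tau>, OF sep that sq] separating_function_pos[OF \<rho>'(1) that]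
    by (simp add: ln_realpow)
  show ?thesis
  proof
    show "\<tau> \<in> feasible \<rho>0"
      using \<rho>'(2) separating_function_pos[OF \<rho>'(1)] by (simp add: feasible_def form)
    have "\<rho> i j = 1 \<longleftrightarrow> i \<noteq> j \<and> log_form \<rho>0 i j \<tau> = 0" for i j
    proof (cases "i = j")
      case True
      then have "\<rho> i j = 0"
        using \<rho>'(1) by (simp add: separating_function_def)
      then show ?thesis using True by simp
    next
      case False
      then show ?thesis
        using form[OF False] separating_function_pos[OF \<rho>'(1) False] by simp
    qed
    then show "R = tight_relation \<rho>0 \<tau>"
      by (simp add: \<rho>(3) unit_relation_def tight_relation_def)
    show "\<exists>j. (i, j) \<in> R" for i
      using \<rho>'(3) by (simp add: \<rho>(3) unit_relation_def)
  qed
qed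

lemma antipodal_relation_tight_relation:
  fixes \<rho>0 :: "'n::finite \<Rightarrow> 'n \<Rightarrow> real"
  assumes sep: "separating_function \<rho>0" and feas: "\<tau> \<in> feasible \<rho>0"
    and total: "\<And>i. \<exists>j. (i, j) \<in> tight_relation \<rho>0 \<tau>"
  shows "antipodal_relation \<rho>0 (tight_relation \<rho>0 \<tau>)"
proof -
  \<comment> \<open>The coordinates are halved because the forms are logarithms of squared
    values.\<close>
  define \<rho> where "\<rho> i j = exp (\<tau> $ i / 2) * exp (\<tau> $ j / 2) * \<rho>0 i j" for i j
  have sep': "separating_function \<rho>"
    using sep by (auto simp: separating_function_def \<rho>_def)
  have sq: "(\<rho> i j)\<^sup>2 = exp (\<tau> $ i + \<tau> $ j) * (\<rho>0 i j)\<^sup>2" for i j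
    by (simp add: \<rho>_def power_mult_distrib exp_add flip: exp_double)
  have form: "log_form \<rho>0 i j \<tau> = 2 * ln (\<rho> i j)" if "i \<noteq> j" for i j
    using log_form_eq_ln[of \<rho>0 i j \<rho> \<tau>, OF sep that sq] separating_function_pos[OF sep' that]
    by (simp add: ln_realpow)
  have diag: "\<rho> i i = 0" for i
    using sep' by (simp add: separating_function_def)
  have unit: "unit_relation \<rho> = tight_relation \<rho>0 \<tau>"
  proof -
    have "\<rho> i j = 1 \<longleftrightarrow> i \<noteq> j \<and> log_form \<rho>0 i j \<tau> = 0" for i j
      using diag form separating_function_pos[OF sep'] by (cases "i = j") auto
    then show ?thesis
      by (simp add: unit_relation_def tight_relation_def)
  qed
  have "\<rho> i j \<le> 1" for i j
  proof (cases "i = j")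
    case False
    then have "log_form \<rho>0 i j \<tau> \<le> 0"
      using feas by (simp add: feasible_def)
    then have "2 * ln (\<rho> i j) \<le> 0"
      by (simp only: form[OF False])
    then show ?thesis
      using separating_function_pos[OF sep' False] by simp
  qed (simp add: diag)
  moreover have "\<exists>j. \<rho> i j = 1" for i
    using total[of i] by (simp add: unit[symmetric] unit_relation_def)
  ultimately have "antipodal_function \<rho>"
    using sep' by (simp add: antipodal_function_iff)
  \<comment> \<open>Each of the four indices contributes the same factor to numerator and
    denominator of the cross-ratio.\<close>
  moreover have "moebius_equivalent \<rho>0 \<rho>"
    by (auto simp: moebius_equivalent_def \<rho>_def)
  ultimately have "\<rho> \<in> antipodal_class \<rho>0"
    by (simp add: antipodal_class_def)
  moreover have "sym (tight_relation \<rho>0 \<tau>)" "tight_relation \<rho>0 \<tau> \<subseteq> - Id"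
    using log_form_commute[OF sep] by (auto simp: sym_def tight_relation_def)
  ultimately show ?thesis
    unfolding antipodal_relation_def using unit by blast
qed

section \<open>Segments between feasible points and beyond them\<close>

text \<open>The forms are affine, so \<open>u\<close> may be any real number; a negative
  \<open>u\<close> describes points beyond \<open>x\<close>.\<close>

lemma log_form_convex_combination:
  "log_form \<rho>0 i j ((1 - u) *\<^sub>R x + u *\<^sub>R y) = (1 - u) * log_form \<rho>0 i j x + u * log_form \<rho>0 i j y"
  by (simp add: log_form_def algebra_simps)

lemma convex_feasible_tight:
  "convex {\<tau> \<in> feasible \<rho>0. R \<subseteq> tight_relation \<rho>0 \<tau>}"
proof (rule convexI)
  fix x y and u v :: real
  assume xy: "x \<in> {\<tau> \<in> feasible \<rho>0. R \<subseteq> tight_relation \<rho>0 \<tau>}"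
    "y \<in> {\<tau> \<in> feasible \<rho>0. R \<subseteq> tight_relation \<rho>0 \<tau>}"
    and uv: "0 \<le> u" "0 \<le> v" "u + v = 1"
  then have u: "u = 1 - v" by simp
  have "log_form \<rho>0 i j (u *\<^sub>R x + v *\<^sub>R y) \<le> 0" if "i \<noteq> j" for i j
    unfolding u log_form_convex_combination using xy uv that
    by (auto simp: feasible_def intro!: add_nonpos_nonpos mult_nonneg_nonpos)
  moreover have "i \<noteq> j \<and> log_form \<rho>0 i j (u *\<^sub>R x + v *\<^sub>R y) = 0" if "(i, j) \<in> R" for i j
    unfolding u log_form_convex_combination using xy that
    by (fastforce simp: tight_relation_def)
  ultimately show "u *\<^sub>R x + v *\<^sub>R y \<in> {\<tau> \<in> feasible \<rho>0. R \<subseteq> tight_relation \<rho>0 \<tau>}"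
    by (auto simp: feasible_def tight_relation_def)
qed

text \<open>A point with the fewest tight constraints works: its midpoint with
  \<open>\<sigma>\<close> is tight exactly where both are, since two nonpositive numbers average to
  0 only if both vanish. The point found stands in for a relative interior point of
  \<open>F\<close>.\<close>

lemma ex_minimal_tight_relation:
  assumes F: "convex F" "F \<noteq> {}" "F \<subseteq> feasible \<rho>0"
  obtains \<tau> where "\<tau> \<in> F" "\<And>\<sigma>. \<sigma> \<in> F \<Longrightarrow> tight_relation \<rho>0 \<tau> \<subseteq> tight_relation \<rho>0 \<sigma>"
proof -
  obtain \<tau> where \<tau>: "\<tau> \<in> F"
    and min: "\<And>\<sigma>. \<sigma> \<in> F \<Longrightarrow> card (tight_relation \<rho>0 \<tau>) \<le> card (tight_relation \<rho>0 \<sigma>)"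
    using F(2) ex_has_least_nat[of "\<lambda>\<tau>. \<tau> \<in> F" _ "\<lambda>\<tau>. card (tight_relation \<rho>0 \<tau>)"] by blast
  have "tight_relation \<rho>0 \<tau> \<subseteq> tight_relation \<rho>0 \<sigma>" if \<sigma>: "\<sigma> \<in> F" for \<sigma>
  proof -
    define m where "m = (1 - 1/2) *\<^sub>R \<tau> + (1/2 :: real) *\<^sub>R \<sigma>"
    have "m \<in> F"
      unfolding m_def using F(1) \<tau> \<sigma> by (intro convexD) auto
    have "tight_relation \<rho>0 m = tight_relation \<rho>0 \<tau> \<inter> tight_relation \<rho>0 \<sigma>"
    proof -
      have "log_form \<rho>0 i j m = 0 \<longleftrightarrow> log_form \<rho>0 i j \<tau> = 0 \<and> log_form \<rho>0 i j \<sigma> = 0"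
        if "i \<noteq> j" for i j
      proof -
        have "log_form \<rho>0 i j \<tau> \<le> 0" "log_form \<rho>0 i j \<sigma> \<le> 0"
          using F(3) \<tau> \<sigma> that by (auto simp: feasible_def)
        then show ?thesis
          unfolding m_def log_form_convex_combination by auto
      qed
      then show ?thesis by (auto simp: tight_relation_def)
    qed
    then show ?thesis
      using min[OF \<open>m \<in> F\<close>] card_seteq[of "tight_relation \<rho>0 \<tau>" "tight_relation \<rho>0 m"] by auto
  qed
  then show ?thesis using that \<tau> by blast
qed

text \<open>Constraints tight at \<open>\<tau>\<close> vanish at both points, hence on the whole
  line; the finitely many others are strict at \<open>\<tau>\<close> and stay so nearby by
  continuity. The shape \<open>1 - (- e)\<close> fits \<open>log_form_convex_combination\<close>
  with \<open>u = - e\<close>.\<close>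

lemma ex_feasible_prolongation:
  fixes x \<tau> :: "real ^ 'n::finite"
  assumes \<tau>: "\<tau> \<in> feasible \<rho>0" and tight: "tight_relation \<rho>0 \<tau> \<subseteq> tight_relation \<rho>0 x"
  obtains e where "e > 0" "(1 - (- e)) *\<^sub>R \<tau> + (- e) *\<^sub>R x \<in> feasible \<rho>0"
proof -
  define y where "y e = (1 - (- e)) *\<^sub>R \<tau> + (- e) *\<^sub>R x" for e
  have "\<forall>\<^sub>F e in at_right 0. log_form \<rho>0 i j (y e) \<le> 0" if ij: "i \<noteq> j" for i j
  proof (cases "(i, j) \<in> tight_relation \<rho>0 \<tau>")
    case True
    then have "log_form \<rho>0 i j (y e) = 0" for e
      unfolding y_def log_form_convex_combination using tight by (auto simp: tight_relation_def)
    then show ?thesis by simp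
  next
    case False
    then have neg: "log_form \<rho>0 i j \<tau> < 0"
      using \<tau> ij by (force simp: feasible_def tight_relation_def)
    have "((\<lambda>e. log_form \<rho>0 i j (y e)) \<longlongrightarrow> log_form \<rho>0 i j \<tau>) (at_right 0)"
      unfolding y_def log_form_convex_combination by (auto intro!: tendsto_eq_intros)
    then have "\<forall>\<^sub>F e in at_right 0. log_form \<rho>0 i j (y e) < 0"
      using neg by (rule order_tendstoD)
    then show ?thesis by (rule eventually_mono) simp
  qed
  then have "\<forall>\<^sub>F e in at_right 0. \<forall>i j. i \<noteq> j \<longrightarrow> log_form \<rho>0 i j (y e) \<le> 0"
    by (simp add: eventually_all_finite)
  then have "\<forall>\<^sub>F e in at_right 0. y e \<in> feasible \<rho>0 \<and> e > (0::real)"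
    by (simp add: feasible_def eventually_conj_iff eventually_at_right_less)
  then obtain e where "y e \<in> feasible \<rho>0" "e > 0"
    using eventually_happens by force
  then show ?thesis using that by (simp add: y_def)
qed

section \<open>Faces of cells\<close>

text \<open>Negating \<open>a\<close> and \<open>b\<close> swaps the two half-spaces, so the support
  can be taken from above.\<close>

lemma nonempty_faceE:
  fixes P :: "'a::euclidean_space set"
  assumes "nonempty_face F P"
  obtains a b where "F \<noteq> {}" "P \<subseteq> {x. a \<bullet> x \<le> b}" "F = {x. a \<bullet> x = b} \<inter> P"
proof -
  obtain a b where ab: "F \<noteq> {}" "P \<subseteq> {x. a \<bullet> x \<le> b} \<or> P \<subseteq> {x. a \<bullet> x \<ge> b}"
    "F = {x. a \<bullet> x = b} \<inter> P"
    using assms unfolding nonempty_face_def by blast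
  show ?thesis
  proof (cases "P \<subseteq> {x. a \<bullet> x \<le> b}")
    case True
    then show ?thesis using ab that by blast
  next
    case False
    then show ?thesis using ab by (intro that[of "- a" "- b"]) auto
  qed
qed

lemma nonempty_face_cell:
  fixes \<rho>0 :: "'n::finite \<Rightarrow> 'n \<Rightarrow> real"
  assumes R: "R1 \<noteq> {}" "R1 \<subseteq> R2" "R2 \<subseteq> - Id" and ne: "cell \<rho>0 R2 \<noteq> {}"
  shows "nonempty_face (cell \<rho>0 R2) (cell \<rho>0 R1)"
proof -
  have R': "R2 \<noteq> {}" "R1 \<subseteq> - Id" using R by auto
  note mem = mem_cell_iff[OF R(1) R'(2), of _ \<rho>0] mem_cell_iff[OF R'(1) R(3), of _ \<rho>0]
  \<comment> \<open>The vector \<open>a\<close> is the linear part of the sum of the forms over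
    \<open>R2\<close>, and \<open>b\<close> is minus its constant part.\<close>
  define a :: "real ^ 'n" where "a = (\<Sum>(i, j)\<in>R2. axis i 1 + axis j 1)"
  define b where "b = - (\<Sum>(i, j)\<in>R2. log_coeff \<rho>0 i j)"
  have sum: "a \<bullet> x - b = (\<Sum>(i, j)\<in>R2. log_form \<rho>0 i j x)" for x
    by (simp add: a_def b_def log_form_def inner_sum_left inner_add_left inner_axis' sum.distrib
        case_prod_unfold)
  \<comment> \<open>Testing against the all-ones vector gives twice the size of the non-empty
    \<open>R2\<close>, so the hyperplane is genuine.\<close>
  have "a \<bullet> (\<chi> k. 1) = (\<Sum>p\<in>R2. 2)"
    by (simp add: a_def inner_sum_left inner_add_left inner_axis' case_prod_unfold)
  then have "a \<noteq> 0"
    using R'(1) by auto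
  have nonpos: "(case p of (i, j) \<Rightarrow> log_form \<rho>0 i j x) \<le> 0" if "x \<in> feasible \<rho>0" "p \<in> R2" for p x
    using that R(3) by (cases p) (auto simp: feasible_def)
  have "cell \<rho>0 R1 \<subseteq> {x. a \<bullet> x \<le> b}"
  proof
    fix x assume "x \<in> cell \<rho>0 R1"
    then have "(\<Sum>(i, j)\<in>R2. log_form \<rho>0 i j x) \<le> 0"
      using nonpos by (intro sum_nonpos) (auto simp: mem)
    then show "x \<in> {x. a \<bullet> x \<le> b}"
      using sum[of x] by simp
  qed
  moreover have "cell \<rho>0 R2 = {x. a \<bullet> x = b} \<inter> cell \<rho>0 R1"
  proof -
    have "a \<bullet> x = b \<longleftrightarrow> R2 \<subseteq> tight_relation \<rho>0 x" if "x \<in> feasible \<rho>0" for x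
    proof -
      have "a \<bullet> x = b \<longleftrightarrow> (\<Sum>(i, j)\<in>R2. log_form \<rho>0 i j x) = 0"
        using sum[of x] by auto
      \<comment> \<open>A sum of nonpositive terms vanishes only if every term does; the signs are
        flipped to fit the rule for nonnegative sums.\<close>
      also have "\<dots> \<longleftrightarrow> (\<forall>(i, j)\<in>R2. log_form \<rho>0 i j x = 0)"
        using nonpos[OF that] sum_nonneg_eq_0_iff[of R2 "\<lambda>(i, j). - log_form \<rho>0 i j x"]
        by (auto simp: case_prod_unfold sum_negf)
      also have "\<dots> \<longleftrightarrow> R2 \<subseteq> tight_relation \<rho>0 x"
        using R(3) by (auto simp: tight_relation_def)
      finally show ?thesis .
    qed
    then show ?thesis
      using R(2) mem by blast
  qed
  ultimately show ?thesis
    unfolding nonempty_face_def using ne \<open>a \<noteq> 0\<close> by blast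
qed

text \<open>Minimality of the tight relation of \<open>\<tau>\<close> puts \<open>F\<close> inside
  its cell. The prolongation argument gives the reverse inclusion.\<close>

lemma nonempty_face_cell_eq_cell_tight_relation:
  fixes \<rho>0 :: "'n::finite \<Rightarrow> 'n \<Rightarrow> real"
  assumes R: "R \<noteq> {}" "R \<subseteq> - Id" and face: "nonempty_face F (cell \<rho>0 R)"
  obtains \<tau> where "\<tau> \<in> cell \<rho>0 R" "F = cell \<rho>0 (tight_relation \<rho>0 \<tau>)"
proof -
  note mem = mem_cell_iff[OF R, of _ \<rho>0]
  obtain a b where F: "F \<noteq> {}" and le: "cell \<rho>0 R \<subseteq> {x. a \<bullet> x \<le> b}"
    and F_eq: "F = {x. a \<bullet> x = b} \<inter> cell \<rho>0 R"
    using face by (rule nonempty_faceE)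
  have "cell \<rho>0 R = {\<tau> \<in> feasible \<rho>0. R \<subseteq> tight_relation \<rho>0 \<tau>}"
    by (auto simp: mem)
  then have "convex F"
    unfolding F_eq using convex_feasible_tight convex_hyperplane by (metis convex_Int)
  moreover have "F \<subseteq> feasible \<rho>0"
    by (auto simp: F_eq mem)
  ultimately obtain \<tau> where \<tau>: "\<tau> \<in> F"
    and min: "\<And>\<sigma>. \<sigma> \<in> F \<Longrightarrow> tight_relation \<rho>0 \<tau> \<subseteq> tight_relation \<rho>0 \<sigma>"
    using ex_minimal_tight_relation[of F \<rho>0] F by blast
  have \<tau>': "\<tau> \<in> feasible \<rho>0" "R \<subseteq> tight_relation \<rho>0 \<tau>" "a \<bullet> \<tau> = b"
    using \<tau> by (auto simp: F_eq mem)
  have T: "tight_relation \<rho>0 \<tau> \<noteq> {}" "tight_relation \<rho>0 \<tau> \<subseteq> - Id"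
    using \<tau>'(2) R(1) by (auto simp: tight_relation_def)
  note memT = mem_cell_iff[OF T, of _ \<rho>0]
  have "x \<in> F" if "x \<in> cell \<rho>0 (tight_relation \<rho>0 \<tau>)" for x
  proof -
    have x: "x \<in> feasible \<rho>0" "tight_relation \<rho>0 \<tau> \<subseteq> tight_relation \<rho>0 x"
      using that by (auto simp: memT)
    then have xR: "x \<in> cell \<rho>0 R"
      using \<tau>'(2) by (auto simp: mem)
    obtain e where e: "e > 0" and y: "(1 - (- e)) *\<^sub>R \<tau> + (- e) *\<^sub>R x \<in> feasible \<rho>0"
      using ex_feasible_prolongation[OF \<tau>'(1) x(2)] .
    let ?y = "(1 - (- e)) *\<^sub>R \<tau> + (- e) *\<^sub>R x"
    \<comment> \<open>The equations of \<open>R\<close> hold at \<open>\<tau>\<close> and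
      \<open>x\<close>, hence along their line, so \<open>?y\<close> stays in the cell of
      \<open>R\<close>.\<close>
    have "log_form \<rho>0 i j ?y = 0" if "(i, j) \<in> R" for i j
    proof -
      have "log_form \<rho>0 i j \<tau> = 0" "log_form \<rho>0 i j x = 0"
        using that \<tau>'(2) x(2) by (auto simp: tight_relation_def)
      then show ?thesis
        unfolding log_form_convex_combination by simp
    qed
    then have "R \<subseteq> tight_relation \<rho>0 ?y"
      using R(2) by (auto simp: tight_relation_def)
    then have "a \<bullet> ?y \<le> b"
      using y le by (auto simp: mem)
    \<comment> \<open>Since \<open>a \<bullet> \<tau> = b\<close>, the value
      \<open>a \<bullet> ?y\<close> equals \<open>b + e * (b - a \<bullet> x)\<close>.\<close>
    then have "e * (b - a \<bullet> x) \<le> 0"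
      using \<tau>'(3) by (simp add: inner_add_right inner_diff_right algebra_simps)
    then have "b \<le> a \<bullet> x"
      using e by (simp add: mult_le_0_iff)
    then show ?thesis
      using xR le by (auto simp: F_eq)
  qed
  moreover have "F \<subseteq> cell \<rho>0 (tight_relation \<rho>0 \<tau>)"
    using min by (auto simp: memT) (auto simp: F_eq mem)
  ultimately show ?thesis
    using that \<tau> F_eq by blast
qed

theorem lemma3p2p3:
  fixes \<rho>0 :: "'n::finite \<Rightarrow> 'n \<Rightarrow> real"
  assumes "CARD('n) \<ge> 4"
    and "antipodal_function \<rho>0"
  shows "(\<forall>R1 R2. antipodal_relation \<rho>0 R1 \<and> antipodal_relation \<rho>0 R2 \<and> R1 \<noteq> {} \<and> R1 \<subseteq> R2
            \<longrightarrow> nonempty_face (cell \<rho>0 R2) (cell \<rho>0 R1)) \<and>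
         (\<forall>R F. antipodal_relation \<rho>0 R \<and> proper_nonempty_face F (cell \<rho>0 R)
            \<longrightarrow> (\<exists>R'. antipodal_relation \<rho>0 R' \<and> R \<subset> R' \<and> F = cell \<rho>0 R'))"
proof (intro conjI allI impI; elim conjE)
  have sep: "separating_function \<rho>0"
    using assms(2) by (simp add: antipodal_function_def)
  {
    fix R1 R2
    assume R: "antipodal_relation \<rho>0 R2" "R1 \<noteq> {}" "R1 \<subseteq> R2"
    then have R2: "R2 \<noteq> {}" "R2 \<subseteq> - Id"
      by (auto simp: antipodal_relation_def)
    obtain \<tau> where "\<tau> \<in> feasible \<rho>0" "R2 = tight_relation \<rho>0 \<tau>"
      using antipodal_relationE[OF assms(1) sep R(1) R2(1)] by metis
    then have "cell \<rho>0 R2 \<noteq> {}"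
      using mem_cell_iff[OF R2] by blast
    then show "nonempty_face (cell \<rho>0 R2) (cell \<rho>0 R1)"
      using nonempty_face_cell R R2 by blast
  next
    fix R F
    assume R: "antipodal_relation \<rho>0 R" and F: "proper_nonempty_face F (cell \<rho>0 R)"
    then have face: "nonempty_face F (cell \<rho>0 R)" and proper: "F \<noteq> cell \<rho>0 R"
      by (auto simp: proper_nonempty_face_def)
    \<comment> \<open>The cell of the empty relation is empty by convention, so it has no non-empty
      face.\<close>
    then have ne: "R \<noteq> {}"
      by (auto simp: nonempty_face_def cell_def)
    have Id: "R \<subseteq> - Id"
      using R by (simp add: antipodal_relation_def)
    obtain \<tau> where \<tau>: "\<tau> \<in> cell \<rho>0 R" "F = cell \<rho>0 (tight_relation \<rho>0 \<tau>)"
      using nonempty_face_cell_eq_cell_tight_relation[OF ne Id face] .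
    then have feas: "\<tau> \<in> feasible \<rho>0" and sub: "R \<subseteq> tight_relation \<rho>0 \<tau>"
      using mem_cell_iff[OF ne Id] by auto
    \<comment> \<open>That every index is related to some other one passes from \<open>R\<close> to
      the larger tight relation and makes it antipodal.\<close>
    have "\<exists>j. (i, j) \<in> R" for i
      using antipodal_relationE[OF assms(1) sep R ne] by metis
    then have "antipodal_relation \<rho>0 (tight_relation \<rho>0 \<tau>)"
      using sub by (intro antipodal_relation_tight_relation[OF sep feas]) blast
    \<comment> \<open>The inclusion is strict because equality of the relations would give
      \<open>F = cell \<rho>0 R\<close>.\<close>
    then show "\<exists>R'. antipodal_relation \<rho>0 R' \<and> R \<subset> R' \<and> F = cell \<rho>0 R'"
      using sub \<tau>(2) proper by blast
  }
qed

end
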